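(* Assume that $\|f(t,x)\|\le l(t)\|x\|$ for all $x\in\Omega$ and all $t\ge t_0$, where $\Omega\subset\mathbb{R}^n$ is a neighborhood of $0$ and $l$ is a continuous function with $l(t)\le \hat l$ for a constant $\hat l$. Assume also that $k(t)$ and $\|F(t)\|$ are continuous and bounded and that $p(t)$ is continuous on $[t_0,\infty)$. Let $x(t,x_0)$ be the solution of $\dot x=A(t)x+f(t,x)+F(t)$, $x(t_0,x_0)=x_0$. Then, for $t_0\le t<\infty$, as long as the solution stays in $\Omega$, $$\|x(t,x_0)\|\le \|x_h(t,x_0)\|+\|x_{nh}(t,x_0)\|,$$ where $$\|x_h(t,x_0)\| = \|W(t)\|\,\|W^{-1}(t_0)x_0\|\exp\Big(\int_{t_0}^t k(s)l(s)\,ds\Big),$$ $$\|x_{nh}(t,x_0)\|=\int_{t_0}^t\theta(t,\tau)k(\tau)\|F(\tau)\|\,d\tau,\qquad \theta(t,\tau)=\exp\Big(\int_\tau^t\big(p(s)+k(s)l(s)\big)ds\Big).$$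
   Context: Consider $\dot x=A(t)x+f(t,x)+F(t)$, $t\in[t_0,\infty)$, $x\in\mathbb{R}^n$, $f(t,0)=0$, where $A(t)\in\mathbb{R}^{n\times n}$, $f:[t_0,\infty)\times\mathbb{R}^n\to\mathbb{R}^n$ and $F(t)\in\mathbb{R}^n$ are continuous and bounded, and $A$ is continuously differentiable. The solution $x(t,x_0)$ with $x(t_0,x_0)=x_0$ is assumed to be uniquely defined for all $t\ge t_0$. $\|\cdot\|$ is the Euclidean norm for vectors and the induced (spectral) norm for matrices. $W(t)$ is a fundamental solution matrix of $\dot x=A(t)x$ with $\|W(t_0)\|=1$; $\sigma_{\max}(t)$ and $\sigma_{\min}(t)$ are its largest and smallest singular values. Standing assumptions: $\sigma_{\max}(t)$ is unique (a simple singular value) for every $t\ge t_0$, and $\sup_{t\ge t_0}\sigma_{\max}\le\bar\sigma$, $\inf_{t\ge t_0}\sigma_{\min}\ge\underline\sigma$ for constants $\bar\sigma,\underline\sigma$. Definitions: $p(t)=\frac{d}{dt}\ln\|W(t)\|$ and $k(t)=\|W(t)\|\,\|W^{-1}(t)\|=\sigma_{\max}(t)/\sigma_{\min}(t)$. The symbols $\|x_h\|$ and $\|x_{nh}\|$ are just names for the scalar functions displayed in the claim. *)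

theory Defs
  imports "HOL-Analysis.Analysis"
begin

text \<open>
  The induced Euclidean (spectral) norm. The type-class norm on matrices is the Frobenius norm,
  so it is not used here.
\<close>

definition spec_norm :: "real^'n^'m \<Rightarrow> real" where
  "spec_norm M = onorm ((*v) M)"

definition cond_number :: "real^'n^'n \<Rightarrow> real" where
  "cond_number M = spec_norm M * spec_norm (matrix_inv M)"

definition singular_values :: "real^'n^'n \<Rightarrow> real set" where
  "singular_values M =
     {s. s \<ge> 0 \<and> (\<exists>v. v \<noteq> 0 \<and> (transpose M ** M) *v v = s\<^sup>2 *\<^sub>R v)}"

definition sigma_max :: "real^'n^'n \<Rightarrow> real" where
  "sigma_max M = Max (singular_values M)"

definition sigma_min :: "real^'n^'n \<Rightarrow> real" where
  "sigma_min M = Min (singular_values M)"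

text \<open>
  The multiplicity of a singular value \<open>s\<close> of \<open>M\<close> is that of the eigenvalue \<open>s\<^sup>2\<close> of the symmetric
  matrix \<open>transpose M ** M\<close>, for which geometric and algebraic multiplicity agree.
\<close>

definition simple_singular_value :: "real^'n^'n \<Rightarrow> real \<Rightarrow> bool" where
  "simple_singular_value M s \<longleftrightarrow>
     s \<in> singular_values M \<and> dim {v. (transpose M ** M) *v v = s\<^sup>2 *\<^sub>R v} = 1"

text \<open>
  All functions of time live on \<open>[t0, \<infinity>)\<close>, so derivatives are taken within \<open>{t0..}\<close>:
  two-sided for \<open>t > t0\<close>, one-sided at \<open>t0\<close>.
\<close>

definition cont_differentiable_from :: "real \<Rightarrow> (real \<Rightarrow> 'a::real_normed_vector) \<Rightarrow> bool" where
  "cont_differentiable_from t0 g \<longleftrightarrow>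
     (\<exists>g'. (\<forall>t\<ge>t0. (g has_vector_derivative g' t) (at t within {t0..})) \<and>
           continuous_on {t0..} g')"

definition fundamental_matrix ::
    "real \<Rightarrow> (real \<Rightarrow> real^'n^'n) \<Rightarrow> (real \<Rightarrow> real^'n^'n) \<Rightarrow> bool" where
  "fundamental_matrix t0 A W \<longleftrightarrow>
     (\<forall>t\<ge>t0. (W has_vector_derivative A t ** W t) (at t within {t0..}) \<and> invertible (W t))"

definition solves_ivp ::
    "real \<Rightarrow> (real \<Rightarrow> 'a \<Rightarrow> 'a) \<Rightarrow> 'a \<Rightarrow> (real \<Rightarrow> 'a::real_normed_vector) \<Rightarrow> bool" where
  "solves_ivp t0 g x0 x \<longleftrightarrow>
     x t0 = x0 \<and> (\<forall>t\<ge>t0. (x has_vector_derivative g t (x t)) (at t within {t0..}))"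

definition unique_ivp_solution ::
    "real \<Rightarrow> (real \<Rightarrow> 'a \<Rightarrow> 'a) \<Rightarrow> 'a \<Rightarrow> (real \<Rightarrow> 'a::real_normed_vector) \<Rightarrow> bool" where
  "unique_ivp_solution t0 g x0 x \<longleftrightarrow>
     solves_ivp t0 g x0 x \<and> (\<forall>y. solves_ivp t0 g x0 y \<longrightarrow> (\<forall>t\<ge>t0. y t = x t))"

definition log_norm_rate :: "real \<Rightarrow> (real \<Rightarrow> real^'n^'n) \<Rightarrow> real \<Rightarrow> real" where
  "log_norm_rate t0 W t = vector_derivative (\<lambda>s. ln (spec_norm (W s))) (at t within {t0..})"

end

theory Submission
  imports Defs
begin

text \<open>
  In the coordinates \<open>y = W\<^sup>-\<^sup>1 x\<close> the linear part of the equation disappears: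
  \<open>y' = W\<^sup>-\<^sup>1 (f + F)\<close> (lemma \<open>variation_of_constants_derivative\<close>). Since \<open>x = W y\<close>, the growth bound
  on \<open>f\<close> gives \<open>\<parallel>y'\<parallel> \<le> k l \<parallel>y\<parallel> + \<parallel>W\<^sup>-\<^sup>1\<parallel> \<parallel>F\<parallel>\<close>, and Gronwall's inequality
  (\<open>gronwall_differential_inequality\<close>) bounds \<open>\<parallel>y(t)\<parallel>\<close>. Multiplying that bound by \<open>\<parallel>W(t)\<parallel>\<close> yields
  the homogeneous term at once; in the other term the factor \<open>\<parallel>W(t)\<parallel> \<parallel>W\<^sup>-\<^sup>1(\<tau>)\<parallel>\<close> appears, which is
  \<open>(\<parallel>W(t)\<parallel> / \<parallel>W(\<tau>)\<parallel>) k(\<tau>)\<close>, and the quotient of norms is the exponential of the integral of \<open>p\<close>.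

  That last equality is where the analytic difficulty lies: the rate \<open>p\<close> is the derivative of
  \<open>ln \<parallel>W\<parallel>\<close> only at times at which \<open>\<parallel>W\<parallel>\<close> is differentiable, and a maximum of smooth functions
  need not be smooth. Simplicity of the largest singular value rescues it. The spectral norm is the
  support function of the compact set of matrices \<open>u v\<^sup>T\<close> with unit vectors \<open>u\<close>, \<open>v\<close>, that is
  \<open>\<parallel>M\<parallel> = max \<langle>u v\<^sup>T, M\<rangle>\<close>. A maximizing \<open>v\<close> is an eigenvector of \<open>M\<^sup>T M\<close> for the largest
  eigenvalue and \<open>u = M v / \<parallel>M\<parallel>\<close>; if the eigenvalue is simple, \<open>v\<close> is determined up to sign, and the
  sign cancels in \<open>u v\<^sup>T\<close>. A support function is differentiable along a differentiable curve wherever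
  its maximizer is unique (\<open>has_vector_derivative_support_function\<close>, a form of Danskin's theorem),
  so \<open>\<parallel>W\<parallel>\<close> is differentiable everywhere and the fundamental theorem of calculus applies
  (\<open>integral_log_norm_rate\<close>).
\<close>

section \<open>Differentiability of support functions\<close>

lemma has_vector_derivative_iff_quotient:
  fixes g :: "real \<Rightarrow> 'a::real_normed_vector"
  shows "(g has_vector_derivative D) (at t within T) \<longleftrightarrow>
    ((\<lambda>s. (g s - g t) /\<^sub>R (s - t)) \<longlongrightarrow> D) (at t within T)"
proof -
  have eq: "norm (g s - g t - (s - t) *\<^sub>R D) / norm (s - t)
      = norm ((g s - g t) /\<^sub>R (s - t) - D)" if "s \<noteq> t" for s
  proof -
    have "(g s - g t) /\<^sub>R (s - t) - D = (g s - g t - (s - t) *\<^sub>R D) /\<^sub>R (s - t)"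
      using that by (simp add: scaleR_diff_right)
    then show ?thesis
      by (simp add: divide_inverse_commute)
  qed
  have "(g has_vector_derivative D) (at t within T) \<longleftrightarrow>
      ((\<lambda>s. norm (g s - g t - (s - t) *\<^sub>R D) / norm (s - t)) \<longlongrightarrow> 0) (at t within T)"
    unfolding has_vector_derivative_def has_derivative_iff_norm
    by (simp add: bounded_linear_scaleR_left)
  also have "\<dots> \<longleftrightarrow> ((\<lambda>s. norm ((g s - g t) /\<^sub>R (s - t) - D)) \<longlongrightarrow> 0) (at t within T)"
    by (rule Lim_cong_within[OF refl refl refl eq])
  also have "\<dots> \<longleftrightarrow> ((\<lambda>s. (g s - g t) /\<^sub>R (s - t)) \<longlongrightarrow> D) (at t within T)"
    by (simp add: tendsto_norm_zero_iff LIM_zero_iff)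
  finally show ?thesis .
qed

text \<open>
  On the part of the compact set that stays away from the unique maximizer, the linear functional is
  smaller than its maximum by a fixed gap. A small perturbation of the functional cannot
  close this gap, so the maximizers of nearby functionals must lie close by.
\<close>

lemma maximizers_tendsto_unique_maximizer:
  fixes M :: "real \<Rightarrow> 'a::real_inner"
  assumes "compact C" and M: "(M \<longlongrightarrow> M t) (at t within T)"
    and c: "\<And>s. s \<in> T \<Longrightarrow> c s \<in> C"
    and max: "\<And>s b. s \<in> T \<Longrightarrow> b \<in> C \<Longrightarrow> inner b (M s) \<le> inner (c s) (M s)"
    and unique: "\<And>b. b \<in> C \<Longrightarrow> inner b (M t) = inner (c t) (M t) \<Longrightarrow> b = c t"
    and "t \<in> T"
  shows "(c \<longlongrightarrow> c t) (at t within T)"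
proof (rule tendstoI)
  fix e :: real
  assume "e > 0"
  define K where "K = C - ball (c t) e"
  have "compact K"
    unfolding K_def using \<open>compact C\<close> by (simp add: compact_diff)
  show "\<forall>\<^sub>F s in at t within T. dist (c s) (c t) < e"
  proof (cases "K = {}")
    case True
    then have "dist (c s) (c t) < e" if "s \<in> T" for s
      using c[OF that] by (auto simp: K_def dist_commute)
    then show ?thesis
      by (simp add: eventually_at_filter)
  next
    case False
    have "continuous_on K (\<lambda>b. inner b (M t))"
      by (intro continuous_intros)
    then obtain k where k: "k \<in> K" "\<And>b. b \<in> K \<Longrightarrow> inner b (M t) \<le> inner k (M t)"
      using continuous_attains_sup[OF \<open>compact K\<close> False] by blast
    have "inner k (M t) \<noteq> inner (c t) (M t)"
      using unique[of k] k(1) \<open>e > 0\<close> by (auto simp: K_def)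
    with max[OF \<open>t \<in> T\<close>, of k] k(1) have gap: "inner k (M t) < inner (c t) (M t)"
      by (auto simp: K_def)
    define \<eta> where "\<eta> = inner (c t) (M t) - inner k (M t)"
    have "\<eta> > 0"
      using gap by (simp add: \<eta>_def)
    obtain B where "B > 0" and B: "\<And>b. b \<in> C \<Longrightarrow> norm b \<le> B"
      using compact_imp_bounded[OF \<open>compact C\<close>] by (auto simp: bounded_pos)
    have "\<forall>\<^sub>F s in at t within T. dist (M s) (M t) < \<eta> / (2 * B)"
      using M \<open>\<eta> > 0\<close> \<open>B > 0\<close> by (intro tendstoD) auto
    moreover have "\<forall>\<^sub>F s in at t within T. s \<in> T"
      by (simp add: eventually_at_filter)
    ultimately show ?thesis
    proof eventually_elim
      case (elim s)
      have small: "\<bar>inner b (M s) - inner b (M t)\<bar> < \<eta> / 2" if "b \<in> C" for b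
      proof -
        have "\<bar>inner b (M s) - inner b (M t)\<bar> \<le> norm b * norm (M s - M t)"
          by (metis Cauchy_Schwarz_ineq2 inner_diff_right)
        also have "\<dots> \<le> B * norm (M s - M t)"
          using B[OF that] by (intro mult_right_mono) auto
        also have "\<dots> < B * (\<eta> / (2 * B))"
          using elim(1) \<open>B > 0\<close> by (intro mult_strict_left_mono) (auto simp: dist_norm)
        finally show ?thesis
          using \<open>B > 0\<close> by simp
      qed
      have "c s \<notin> K"
      proof
        assume "c s \<in> K"
        then have "inner (c s) (M t) \<le> inner (c t) (M t) - \<eta>"
          using k(2) by (simp add: \<eta>_def)
        moreover have "inner (c t) (M s) \<le> inner (c s) (M s)"
          using max elim(2) c \<open>t \<in> T\<close> by blast
        ultimately show False
          using small[OF c[OF elim(2)]] small[OF c[OF \<open>t \<in> T\<close>]] by linarith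
      qed
      then show ?case
        using c[OF elim(2)] by (simp add: K_def dist_commute)
    qed
  qed
qed

text \<open>
  Danskin's theorem for support functions. Comparing the maximizers at two times traps the increment
  of the maximum between \<open>\<langle>c(t), M(s) - M(t)\<rangle>\<close> and \<open>\<langle>c(s), M(s) - M(t)\<rangle>\<close>; these differ by
  \<open>o(s - t)\<close> because \<open>c(s)\<close> converges to \<open>c(t)\<close>.
\<close>

lemma has_vector_derivative_support_function:
  fixes M :: "real \<Rightarrow> 'a::real_inner"
  assumes "compact C" and M: "(M has_vector_derivative M') (at t within T)"
    and c: "\<And>s. s \<in> T \<Longrightarrow> c s \<in> C"
    and max: "\<And>s b. s \<in> T \<Longrightarrow> b \<in> C \<Longrightarrow> inner b (M s) \<le> inner (c s) (M s)"
    and unique: "\<And>b. b \<in> C \<Longrightarrow> inner b (M t) = inner (c t) (M t) \<Longrightarrow> b = c t"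
    and "t \<in> T"
  shows "((\<lambda>s. inner (c s) (M s)) has_vector_derivative inner (c t) M') (at t within T)"
proof -
  define q where "q s = (M s - M t) /\<^sub>R (s - t)" for s
  define \<phi> where "\<phi> s = inner (c s) (M s)" for s
  have q: "(q \<longlongrightarrow> M') (at t within T)"
    using M unfolding has_vector_derivative_iff_quotient q_def[abs_def] .
  have "(M \<longlongrightarrow> M t) (at t within T)"
    using has_vector_derivative_continuous[OF M] by (simp add: continuous_within)
  then have "(c \<longlongrightarrow> c t) (at t within T)"
    by (rule maximizers_tendsto_unique_maximizer
        [where M = M and c = c and t = t, OF \<open>compact C\<close> _ c max unique \<open>t \<in> T\<close>])
  then have err: "((\<lambda>s. norm (c s - c t) * norm (q s)) \<longlongrightarrow> 0) (at t within T)"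
    using tendsto_mult[OF tendsto_norm[OF Lim_null[THEN iffD1]] tendsto_norm[OF q]] by force
  have "((\<lambda>s. (\<phi> s - \<phi> t) / (s - t) - inner (c t) (q s)) \<longlongrightarrow> 0) (at t within T)"
  proof (rule Lim_null_comparison[OF _ err])
    show "\<forall>\<^sub>F s in at t within T. norm ((\<phi> s - \<phi> t) / (s - t) - inner (c t) (q s))
        \<le> norm (c s - c t) * norm (q s)"
      unfolding eventually_at_filter
    proof (intro always_eventually allI impI)
      fix s
      assume "s \<noteq> t" "s \<in> T"
      let ?d = "\<phi> s - \<phi> t - inner (c t) (M s - M t)"
      \<comment> \<open>Each maximizer is a competitor for the other time, so the increment of the maximum
        lies between the increments of the two competitors.\<close>
      have "0 \<le> ?d"
        using max[OF \<open>s \<in> T\<close> c[OF \<open>t \<in> T\<close>]] by (simp add: \<phi>_def inner_diff_right)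
      moreover have "?d \<le> inner (c s - c t) (M s - M t)"
        using max[OF \<open>t \<in> T\<close> c[OF \<open>s \<in> T\<close>]] by (simp add: \<phi>_def inner_diff_right inner_diff_left)
      ultimately have "\<bar>?d\<bar> \<le> norm (c s - c t) * norm (M s - M t)"
        using norm_cauchy_schwarz[of "c s - c t" "M s - M t"] by linarith
      then have "\<bar>?d\<bar> / \<bar>s - t\<bar> \<le> norm (c s - c t) * norm (M s - M t) / \<bar>s - t\<bar>"
        by (intro divide_right_mono) auto
      moreover have "(\<phi> s - \<phi> t) / (s - t) - inner (c t) (q s) = ?d / (s - t)"
        by (simp add: q_def divide_inverse algebra_simps)
      moreover have "norm (q s) = norm (M s - M t) / \<bar>s - t\<bar>"
        by (simp add: q_def divide_inverse_commute)
      ultimately show "norm ((\<phi> s - \<phi> t) / (s - t) - inner (c t) (q s))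
          \<le> norm (c s - c t) * norm (q s)"
        by simp
    qed
  qed
  moreover have "((\<lambda>s. inner (c t) (q s)) \<longlongrightarrow> inner (c t) M') (at t within T)"
    by (intro tendsto_intros q)
  ultimately have "((\<lambda>s. (\<phi> s - \<phi> t) / (s - t)) \<longlongrightarrow> inner (c t) M') (at t within T)"
    using tendsto_add by fastforce
  then show ?thesis
    by (simp add: has_vector_derivative_iff_quotient \<phi>_def divide_inverse_commute)
qed

section \<open>The spectral norm\<close>

lemma norm_mult_le_spec_norm: "norm (M *v v) \<le> spec_norm M * norm v"
  for M :: "real^'n^'m"
  unfolding spec_norm_def by (rule onorm[OF matrix_vector_mul_bounded_linear])

lemma spec_norm_nonneg: "0 \<le> spec_norm M"
  for M :: "real^'n^'m"
  unfolding spec_norm_def by (rule onorm_pos_le[OF matrix_vector_mul_bounded_linear])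

lemma spec_norm_attained:
  fixes M :: "real^'n^'m"
  obtains v where "norm v = 1" "norm (M *v v) = spec_norm M"
proof -
  have "continuous_on (sphere 0 1) (\<lambda>v::real^'n. norm (M *v v))"
    by (intro continuous_on_norm linear_continuous_on) auto
  then obtain v :: "real^'n" where v: "norm v = 1"
      and max: "\<And>w. norm w = 1 \<Longrightarrow> norm (M *v w) \<le> norm (M *v v)"
    using continuous_attains_sup[of "sphere (0::real^'n) 1" "\<lambda>v. norm (M *v v)"] by auto
  have "norm (M *v w) \<le> norm (M *v v) * norm w" for w
  proof (cases "w = 0")
    case False
    have "norm (M *v (w /\<^sub>R norm w)) \<le> norm (M *v v)"
      using False by (intro max) simp
    then show ?thesis
      using False by (simp add: matrix_vector_mult_scaleR field_simps)
  qed simp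
  then have "spec_norm M \<le> norm (M *v v)"
    unfolding spec_norm_def by (intro onorm_le)
  moreover have "norm (M *v v) \<le> spec_norm M"
    using norm_mult_le_spec_norm[of M v] v by simp
  ultimately show ?thesis
    using that v by force
qed

lemma inner_transpose_mult: "inner (transpose M *v w) v = inner w (M *v v)"
  for M :: "real^'n^'m"
  by (simp add: dot_lmul_matrix)

text \<open>Half of the fact that a matrix and its transpose have the same spectral norm.\<close>

lemma norm_transpose_mult_le: "norm (transpose M *v w) \<le> spec_norm M * norm w"
  for M :: "real^'n^'m"
proof -
  have "norm (transpose M *v w) * norm (transpose M *v w) = inner w (M *v (transpose M *v w))"
    by (metis inner_transpose_mult norm_eq_sqrt_inner power2_eq_square real_sqrt_pow2 inner_ge_zero)
  also have "\<dots> \<le> norm w * (spec_norm M * norm (transpose M *v w))"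
    by (meson norm_cauchy_schwarz norm_mult_le_spec_norm mult_left_mono norm_ge_zero order_trans)
  finally have "norm (transpose M *v w) * norm (transpose M *v w)
      \<le> (spec_norm M * norm w) * norm (transpose M *v w)"
    by (simp add: mult_ac)
  then show ?thesis
    using spec_norm_nonneg[of M] by (cases "transpose M *v w = 0") (auto simp del: transpose_matrix_vector)
qed

text \<open>
  With \<open>\<sigma> = \<parallel>M\<parallel>\<close> and \<open>z = M\<^sup>T M v\<close>, expanding the square gives
  \<open>\<parallel>z - \<sigma>\<^sup>2 v\<parallel>\<^sup>2 = \<parallel>z\<parallel>\<^sup>2 - \<sigma>\<^sup>4\<close>, which is not positive because \<open>\<parallel>z\<parallel> \<le> \<sigma>\<^sup>2\<close>.
\<close>

lemma spec_norm_maximizer_is_singular_vector: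
  fixes M :: "real^'n^'m"
  assumes "norm v = 1" and v: "norm (M *v v) = spec_norm M"
  shows "(transpose M ** M) *v v = (spec_norm M)\<^sup>2 *\<^sub>R v"
proof -
  let ?\<sigma> = "spec_norm M" and ?z = "transpose M *v (M *v v)"
  have zv: "inner ?z v = ?\<sigma>\<^sup>2"
    by (simp only: inner_transpose_mult v flip: power2_norm_eq_inner)
  have "norm ?z \<le> ?\<sigma>\<^sup>2"
    using norm_transpose_mult_le[of M "M *v v"] v by (simp add: power2_eq_square)
  then have "(norm ?z)\<^sup>2 \<le> (?\<sigma>\<^sup>2)\<^sup>2"
    by (intro power_mono) auto
  moreover have "(norm (?z - ?\<sigma>\<^sup>2 *\<^sub>R v))\<^sup>2 = (norm ?z)\<^sup>2 - (?\<sigma>\<^sup>2)\<^sup>2"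
  proof -
    have "inner v v = 1"
      using \<open>norm v = 1\<close> by (simp flip: power2_norm_eq_inner)
    then show ?thesis
      using zv unfolding power2_norm_eq_inner
      by (simp add: inner_diff_left inner_diff_right inner_commute power2_eq_square
          del: transpose_matrix_vector)
  qed
  ultimately have "?z - ?\<sigma>\<^sup>2 *\<^sub>R v = 0"
    by (metis diff_le_0_iff_le norm_eq_zero power2_less_eq_zero_iff)
  then show ?thesis
    by (simp del: transpose_matrix_vector add: matrix_vector_mul_assoc)
qed

text \<open>
  Eigenvectors of a symmetric matrix for distinct eigenvalues are orthogonal, hence independent.
  Finiteness is what makes the maximum that defines \<^const>\<open>sigma_max\<close> meaningful.
\<close>

lemma finite_singular_values: "finite (singular_values M)"
  for M :: "real^'n^'n"
proof -
  let ?e = "\<lambda>s. SOME v. v \<noteq> 0 \<and> (transpose M ** M) *v v = s\<^sup>2 *\<^sub>R v"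
  have e: "?e s \<noteq> 0" "(transpose M ** M) *v ?e s = s\<^sup>2 *\<^sub>R ?e s"
    if "s \<in> singular_values M" for s
    using someI_ex[of "\<lambda>v. v \<noteq> 0 \<and> (transpose M ** M) *v v = s\<^sup>2 *\<^sub>R v"] that
    by (auto simp: singular_values_def)
  have orth: "inner (?e s) (?e r) = 0"
    if "s \<in> singular_values M" "r \<in> singular_values M" "s \<noteq> r" for s r
  proof -
    have "inner ((transpose M ** M) *v v) w = inner v ((transpose M ** M) *v w)" for v w
      by (metis inner_transpose_mult inner_commute matrix_vector_mul_assoc)
    from this[of "?e s" "?e r"] have "(s\<^sup>2 - r\<^sup>2) * inner (?e s) (?e r) = 0"
      unfolding e(2)[OF that(1)] e(2)[OF that(2)] by (simp add: algebra_simps)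
    moreover have "s\<^sup>2 \<noteq> r\<^sup>2"
      using that by (auto simp: singular_values_def)
    ultimately show ?thesis
      by simp
  qed
  have "inj_on ?e (singular_values M)"
  proof (rule inj_onI, rule ccontr)
    fix s r
    assume sr: "s \<in> singular_values M" "r \<in> singular_values M" "?e s = ?e r" "s \<noteq> r"
    then show False
      using orth[of s r] e(1)[of r] by simp
  qed
  moreover have "independent (?e ` singular_values M)"
  proof (rule pairwise_orthogonal_independent)
    show "pairwise orthogonal (?e ` singular_values M)"
      using orth by (force simp: pairwise_def orthogonal_def)
    show "0 \<notin> ?e ` singular_values M"
      using e(1) by force
  qed
  ultimately show ?thesis
    using independent_imp_finite finite_image_iff by blast
qed

lemma sigma_max_eq_spec_norm: "sigma_max M = spec_norm M"
  for M :: "real^'n^'n"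
  unfolding sigma_max_def
proof (rule Max_eqI[OF finite_singular_values])
  obtain v where "norm v = 1" "norm (M *v v) = spec_norm M"
    using spec_norm_attained .
  moreover from this(1) have "v \<noteq> 0"
    by auto
  ultimately show "spec_norm M \<in> singular_values M"
    unfolding singular_values_def
    using spec_norm_maximizer_is_singular_vector spec_norm_nonneg[of M] by blast
next
  fix s
  assume "s \<in> singular_values M"
  then obtain v where "s \<ge> 0" "v \<noteq> 0" and v: "(transpose M ** M) *v v = s\<^sup>2 *\<^sub>R v"
    by (auto simp: singular_values_def)
  have "(norm (M *v v))\<^sup>2 = inner ((transpose M ** M) *v v) v"
    by (simp only: inner_transpose_mult power2_norm_eq_inner flip: matrix_vector_mul_assoc)
  also have "\<dots> = (s * norm v)\<^sup>2"
    unfolding v by (simp add: power_mult_distrib power2_norm_eq_inner)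
  finally have "norm (M *v v) = s * norm v"
    using \<open>s \<ge> 0\<close> by (simp add: power2_eq_iff_nonneg)
  then show "s \<le> spec_norm M"
    using norm_mult_le_spec_norm[of M v] \<open>v \<noteq> 0\<close> by simp
qed

lemma unit_vectors_of_line:
  fixes V :: "'a::euclidean_space set"
  assumes "subspace V" "dim V = 1" "v \<in> V" "w \<in> V" "norm v = 1" "norm w = 1"
  shows "w = v \<or> w = - v"
proof -
  have "span {v} = V"
  proof (rule subspace_dim_equal)
    show "dim V \<le> dim (span {v})"
      using assms by (auto simp: dim_insert)
    show "span {v} \<subseteq> V"
      using assms by (simp add: span_minimal)
  qed (use assms in auto)
  then obtain a where a: "w = a *\<^sub>R v"
    using assms by (auto simp: span_singleton)
  then have "\<bar>a\<bar> = 1"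
    using assms by simp
  then show ?thesis
    using a by (auto simp: abs_if split: if_splits)
qed

section \<open>The spectral norm as a support function\<close>

text \<open>
  The inner product on matrices is the entrywise one, so that \<open>\<langle>u v\<^sup>T, M\<rangle>\<close> is the bilinear form
  \<open>\<langle>u, M v\<rangle>\<close>. Using the matrices \<open>u v\<^sup>T\<close> instead of the pairs \<open>(u, v)\<close> makes the norm a maximum of
  linear functionals and identifies the two maximizing pairs \<open>(u, v)\<close> and \<open>(-u, -v)\<close>.
\<close>

definition outer_product :: "real^'m \<Rightarrow> real^'n \<Rightarrow> real^'n^'m" where
  "outer_product u v = (\<chi> i j. u $ i * v $ j)"

lemma inner_outer_product: "inner (outer_product u v) M = inner u (M *v v)"
  by (simp add: outer_product_def inner_vec_def matrix_vector_mult_def sum_distrib_left mult_ac)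

lemma outer_product_minus_minus: "outer_product (- u) (- v) = outer_product u v"
  by (simp add: outer_product_def)

definition unit_outer_products :: "(real^'n^'m) set" where
  "unit_outer_products = (\<lambda>(u, v). outer_product u v) ` (sphere 0 1 \<times> sphere 0 1)"

lemma compact_unit_outer_products: "compact unit_outer_products"
  unfolding unit_outer_products_def outer_product_def
  by (intro compact_continuous_image compact_Times compact_sphere)
     (auto simp: case_prod_unfold intro!: continuous_intros)

lemma inner_unit_outer_product_le:
  fixes M :: "real^'n^'m"
  assumes "c \<in> unit_outer_products"
  shows "inner c M \<le> spec_norm M"
proof -
  obtain u v where uv: "norm u = 1" "norm v = 1" "c = outer_product u v"
    using assms by (auto simp: unit_outer_products_def)
  then show ?thesis
    using norm_cauchy_schwarz[of u "M *v v"] norm_mult_le_spec_norm[of M v]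
    by (simp add: inner_outer_product)
qed

lemma inner_unit_outer_product_attained:
  fixes M :: "real^'n^'m"
  assumes "spec_norm M > 0"
  obtains c where "c \<in> unit_outer_products" "inner c M = spec_norm M"
proof -
  obtain v where v: "norm v = 1" "norm (M *v v) = spec_norm M"
    using spec_norm_attained .
  let ?u = "(M *v v) /\<^sub>R spec_norm M"
  have "outer_product ?u v \<in> unit_outer_products"
    unfolding unit_outer_products_def using v assms by (force intro!: image_eqI[where x = "(?u, v)"])
  moreover have "inner (outer_product ?u v) M = spec_norm M"
    using v assms by (simp add: inner_outer_product power2_eq_square flip: power2_norm_eq_inner)
  ultimately show ?thesis
    using that by blast
qed

text \<open>
  Equality in the Cauchy--Schwarz inequality forces \<open>u = M v / \<parallel>M\<parallel>\<close>, and \<open>v\<close> lies on the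
  eigenline of the simple largest singular value. So \<open>v\<close> is unique up to sign, and \<open>u\<close> changes sign
  along with it.
\<close>

lemma unit_outer_product_maximizer_unique:
  fixes M :: "real^'n^'n"
  assumes simple: "simple_singular_value M (sigma_max M)" and pos: "spec_norm M > 0"
    and b: "b \<in> unit_outer_products" "inner b M = spec_norm M"
    and c: "c \<in> unit_outer_products" "inner c M = spec_norm M"
  shows "b = c"
proof -
  let ?V = "{v. (transpose M ** M) *v v = (spec_norm M)\<^sup>2 *\<^sub>R v}"
  have "subspace ?V"
    unfolding subspace_def
    by (simp add: matrix_vector_right_distrib matrix_vector_mult_scaleR scaleR_right_distrib)
  have "dim ?V = 1"
    using simple by (simp add: simple_singular_value_def sigma_max_eq_spec_norm)
  have maximizer: "u = (M *v v) /\<^sub>R spec_norm M \<and> v \<in> ?V"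
    if uv: "norm u = 1" "norm v = 1" "inner u (M *v v) = spec_norm M" for u v
  proof -
    have "norm (M *v v) \<le> spec_norm M"
      using norm_mult_le_spec_norm[of M v] uv by simp
    moreover have "spec_norm M \<le> norm (M *v v)"
      using norm_cauchy_schwarz[of u "M *v v"] uv by simp
    ultimately have Mv: "norm (M *v v) = spec_norm M"
      by simp
    then have "norm u *\<^sub>R (M *v v) = norm (M *v v) *\<^sub>R u"
      using uv by (subst norm_cauchy_schwarz_eq[symmetric]) simp
    then show ?thesis
      using uv Mv pos spec_norm_maximizer_is_singular_vector[of v M] by (simp add: divideR_right)
  qed
  obtain u v where uv: "norm u = 1" "norm v = 1" "b = outer_product u v"
    using b by (auto simp: unit_outer_products_def)
  obtain u' v' where uv': "norm u' = 1" "norm v' = 1" "c = outer_product u' v'"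
    using c by (auto simp: unit_outer_products_def)
  have m: "u = (M *v v) /\<^sub>R spec_norm M" "v \<in> ?V"
      and m': "u' = (M *v v') /\<^sub>R spec_norm M" "v' \<in> ?V"
    using maximizer[of u v] maximizer[of u' v'] uv uv' b c by (auto simp: inner_outer_product)
  have "v' = v \<or> v' = - v"
    by (rule unit_vectors_of_line[OF \<open>subspace ?V\<close> \<open>dim ?V = 1\<close> m(2) m'(2) uv(2) uv'(2)])
  then show ?thesis
  proof
    assume "v' = v"
    then show ?thesis
      using m m' uv uv' by simp
  next
    assume "v' = - v"
    then have "u' = - u"
      using m(1) m'(1) by (simp add: linear_neg[OF matrix_vector_mul_linear])
    with \<open>v' = - v\<close> show ?thesis
      using uv uv' by (simp add: outer_product_minus_minus)
  qed
qed

lemma spec_norm_differentiable: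
  fixes M :: "real \<Rightarrow> real^'n^'n"
  assumes M: "(M has_vector_derivative M') (at t within T)" and "t \<in> T"
    and pos: "\<And>s. s \<in> T \<Longrightarrow> spec_norm (M s) > 0"
    and simple: "simple_singular_value (M t) (sigma_max (M t))"
  obtains D where "((\<lambda>s. spec_norm (M s)) has_vector_derivative D) (at t within T)"
proof -
  have "\<exists>c. c \<in> unit_outer_products \<and> inner c (M s) = spec_norm (M s)" if "s \<in> T" for s
    using inner_unit_outer_product_attained[OF pos[OF that]] by blast
  then obtain c where c: "\<And>s. s \<in> T \<Longrightarrow> c s \<in> unit_outer_products"
      and max: "\<And>s. s \<in> T \<Longrightarrow> inner (c s) (M s) = spec_norm (M s)"
    by metis
  have "((\<lambda>s. inner (c s) (M s)) has_vector_derivative inner (c t) M') (at t within T)"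
  proof (rule has_vector_derivative_support_function[OF compact_unit_outer_products M c _ _ \<open>t \<in> T\<close>])
    fix s and b :: "real^'n^'n"
    assume "s \<in> T" "b \<in> unit_outer_products"
    then show "inner b (M s) \<le> inner (c s) (M s)"
      by (simp add: max inner_unit_outer_product_le)
  next
    fix b :: "real^'n^'n"
    assume "b \<in> unit_outer_products" "inner b (M t) = inner (c t) (M t)"
    then show "b = c t"
      using unit_outer_product_maximizer_unique[OF simple pos] c max \<open>t \<in> T\<close> by simp
  qed
  then have "((\<lambda>s. spec_norm (M s)) has_vector_derivative inner (c t) M') (at t within T)"
    by (rule has_vector_derivative_transform[OF \<open>t \<in> T\<close>, rotated]) (simp add: max)
  then show ?thesis
    using that by blast
qed


section \<open>Variation of constants and Gronwall's inequality\<close>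

lemma matrix_inv_right_left:
  fixes M :: "real^'n^'n"
  assumes "invertible M"
  shows "M ** matrix_inv M = mat 1" "matrix_inv M ** M = mat 1"
  using someI_ex[OF assms[unfolded invertible_def]] by (simp_all add: matrix_inv_def)

lemma spec_norm_pos:
  fixes M :: "real^'n^'n"
  assumes "invertible M"
  shows "spec_norm M > 0"
proof (rule ccontr)
  assume "\<not> spec_norm M > 0"
  then have "M *v v = 0" for v
    using norm_mult_le_spec_norm[of M v] spec_norm_nonneg[of M] by simp
  then have "v = 0" for v :: "real^'n"
    using matrix_inv_right_left(2)[OF assms]
    by (metis matrix_vector_mul_assoc matrix_vector_mul_lid matrix_vector_mult_0_right)
  from this[of "axis undefined 1"] show False
    by (simp add: axis_eq_0_iff)
qed

lemma bounded_bilinear_matrix_vector_mult: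
  "bounded_bilinear ((*v) :: real^'n^'m \<Rightarrow> real^'n \<Rightarrow> real^'m)"
  unfolding bilinear_conv_bounded_bilinear[symmetric] bilinear_def
  by (auto intro!: linearI simp: matrix_vector_mult_add_rdistrib matrix_vector_right_distrib
      matrix_vector_mult_scaleR scaleR_matrix_vector_assoc)

text \<open>
  The derivative of \<open>W\<^sup>-\<^sup>1\<close> itself is bypassed. Multiplied by \<open>W(s)\<close>, the difference quotient of
  \<open>y = W\<^sup>-\<^sup>1 x\<close> between \<open>t\<close> and \<open>s\<close> becomes \<open>(x(s) - W(s) y(t)) / (s - t)\<close>, which only involves the
  quotients of \<open>x\<close> and \<open>W\<close> and tends to \<open>A x + g - A W y = g\<close>. Continuity of \<open>\<parallel>W\<^sup>-\<^sup>1\<parallel>\<close> controls the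
  error made when \<open>W(s)\<close> is divided out again.
\<close>

lemma variation_of_constants_derivative:
  fixes W :: "real \<Rightarrow> real^'n^'n" and x :: "real \<Rightarrow> real^'n"
  assumes W: "(W has_vector_derivative A ** W t) (at t within T)"
    and x: "(x has_vector_derivative A *v x t + g) (at t within T)"
    and inv: "\<And>s. s \<in> T \<Longrightarrow> invertible (W s)" and "t \<in> T"
    and n: "continuous (at t within T) (\<lambda>s. spec_norm (matrix_inv (W s)))"
  shows "((\<lambda>s. matrix_inv (W s) *v x s) has_vector_derivative matrix_inv (W t) *v g) (at t within T)"
proof -
  note tendsto_mult_vec = bounded_bilinear.tendsto[OF bounded_bilinear_matrix_vector_mult]
  define y where "y s = matrix_inv (W s) *v x s" for s
  define q where "q s = (x s - x t) /\<^sub>R (s - t) - ((W s - W t) /\<^sub>R (s - t)) *v y t" for s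
  have Wy: "W t *v y t = x t"
    by (simp add: y_def matrix_vector_mul_assoc matrix_inv_right_left inv \<open>t \<in> T\<close>)
  have "(q \<longlongrightarrow> (A *v x t + g) - (A ** W t) *v y t) (at t within T)"
    unfolding q_def using x W
    by (intro tendsto_diff tendsto_mult_vec tendsto_const)
       (simp_all add: has_vector_derivative_iff_quotient)
  then have q: "(q \<longlongrightarrow> g) (at t within T)"
    by (simp add: Wy flip: matrix_vector_mul_assoc)
  have Wt: "(W \<longlongrightarrow> W t) (at t within T)"
    using has_vector_derivative_continuous[OF W] by (simp add: continuous_within)
  have "((\<lambda>s. q s - W s *v (matrix_inv (W t) *v g)) \<longlongrightarrow>
      g - W t *v (matrix_inv (W t) *v g)) (at t within T)"
    by (intro tendsto_diff q tendsto_mult_vec Wt tendsto_const)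
  then have "((\<lambda>s. q s - W s *v (matrix_inv (W t) *v g)) \<longlongrightarrow> 0) (at t within T)"
    by (simp add: matrix_vector_mul_assoc matrix_inv_right_left inv \<open>t \<in> T\<close>)
  then have err: "((\<lambda>s. spec_norm (matrix_inv (W s)) * norm (q s - W s *v (matrix_inv (W t) *v g)))
      \<longlongrightarrow> 0) (at t within T)"
    using tendsto_mult[OF n[unfolded continuous_within] tendsto_norm_zero] by fastforce
  have "((\<lambda>s. (y s - y t) /\<^sub>R (s - t) - matrix_inv (W t) *v g) \<longlongrightarrow> 0) (at t within T)"
  proof (rule Lim_null_comparison[OF _ err])
    show "\<forall>\<^sub>F s in at t within T. norm ((y s - y t) /\<^sub>R (s - t) - matrix_inv (W t) *v g)
      \<le> spec_norm (matrix_inv (W s)) * norm (q s - W s *v (matrix_inv (W t) *v g))"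
      unfolding eventually_at_filter
    proof (intro always_eventually allI impI)
      fix s
      assume "s \<noteq> t" "s \<in> T"
      have cancel: "matrix_inv (W s) *v (W s *v w) = w" for w
        by (simp add: matrix_vector_mul_assoc matrix_inv_right_left inv \<open>s \<in> T\<close>)
      have "q s = (x s - W s *v y t) /\<^sub>R (s - t)"
        by (simp add: q_def Wy algebra_simps flip: scaleR_matrix_vector_assoc)
      then have "matrix_inv (W s) *v q s = (y s - y t) /\<^sub>R (s - t)"
        by (simp add: matrix_vector_mult_scaleR matrix_vector_mult_diff_distrib cancel y_def)
      then have "(y s - y t) /\<^sub>R (s - t) - matrix_inv (W t) *v g
          = matrix_inv (W s) *v (q s - W s *v (matrix_inv (W t) *v g))"
        by (simp add: matrix_vector_mult_diff_distrib cancel)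
      then show "norm ((y s - y t) /\<^sub>R (s - t) - matrix_inv (W t) *v g)
          \<le> spec_norm (matrix_inv (W s)) * norm (q s - W s *v (matrix_inv (W t) *v g))"
        by (simp add: norm_mult_le_spec_norm)
    qed
  qed
  then have "((\<lambda>s. (y s - y t) /\<^sub>R (s - t)) \<longlongrightarrow> matrix_inv (W t) *v g) (at t within T)"
    by (simp add: LIM_zero_iff)
  then show ?thesis
    by (simp add: has_vector_derivative_iff_quotient y_def)
qed

text \<open>
  The norm of \<open>y\<close> may fail to be differentiable where \<open>y\<close> vanishes, so it is first compared with the
  differentiable majorant \<open>R(s) = \<parallel>y(a)\<parallel> + \<integral> (\<alpha> \<parallel>y\<parallel> + \<beta>)\<close>. The sign of \<open>\<alpha>\<close> then allows
  \<open>\<parallel>y\<parallel>\<close> to be replaced by \<open>R\<close> in \<open>R' = \<alpha> \<parallel>y\<parallel> + \<beta>\<close>.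
\<close>

lemma gronwall_differential_inequality:
  fixes y :: "real \<Rightarrow> 'a::real_normed_vector" and \<alpha> \<beta> :: "real \<Rightarrow> real"
  assumes "a \<le> b"
    and \<alpha>: "continuous_on {a..b} \<alpha>" "\<And>s. s \<in> {a..b} \<Longrightarrow> 0 \<le> \<alpha> s"
    and \<beta>: "continuous_on {a..b} \<beta>"
    and y: "\<And>s. s \<in> {a..b} \<Longrightarrow> (y has_vector_derivative y' s) (at s within {a..b})"
    and y': "\<And>s. s \<in> {a..b} \<Longrightarrow> norm (y' s) \<le> \<alpha> s * norm (y s) + \<beta> s"
  shows "norm (y b) \<le> exp (integral {a..b} \<alpha>) *
    (norm (y a) + integral {a..b} (\<lambda>\<tau>. exp (- integral {a..\<tau>} \<alpha>) * \<beta> \<tau>))"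
proof (cases "a = b")
  case False
  then have "a < b"
    using \<open>a \<le> b\<close> by simp
  define u where "u s = \<alpha> s * norm (y s) + \<beta> s" for s
  define P where "P s = integral {a..s} \<alpha>" for s
  define R where "R s = norm (y a) + integral {a..s} u" for s
  define S where "S s = integral {a..s} (\<lambda>\<tau>. exp (- P \<tau>) * \<beta> \<tau>)" for s
  have y_cont: "continuous_on {a..b} y"
    using has_vector_derivative_continuous[OF y] by (simp add: continuous_on_eq_continuous_within)
  have u_cont: "continuous_on {a..b} u"
    unfolding u_def by (intro continuous_intros \<alpha> \<beta> y_cont)
  have P: "(P has_vector_derivative \<alpha> s) (at s within {a..b})" if "s \<in> {a..b}" for s
    unfolding P_def by (rule integral_has_vector_derivative[OF \<alpha>(1) that])
  have R: "(R has_vector_derivative u s) (at s within {a..b})" if "s \<in> {a..b}" for s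
    unfolding R_def
    using integral_has_vector_derivative[OF u_cont that] by (auto intro!: derivative_eq_intros)
  have P_cont: "continuous_on {a..b} P"
    using has_vector_derivative_continuous[OF P] by (simp add: continuous_on_eq_continuous_within)
  have R_cont: "continuous_on {a..b} R"
    using has_vector_derivative_continuous[OF R] by (simp add: continuous_on_eq_continuous_within)
  have S: "(S has_vector_derivative exp (- P s) * \<beta> s) (at s within {a..b})" if "s \<in> {a..b}" for s
    unfolding S_def
    by (rule integral_has_vector_derivative[OF _ that]) (intro continuous_intros \<beta> P_cont)
  have S_cont: "continuous_on {a..b} S"
    using has_vector_derivative_continuous[OF S] by (simp add: continuous_on_eq_continuous_within)
  have inner_at: "at s within {a..b} = at s" if "a < s" "s < b" for s
    using that by (simp add: at_within_Icc_at)
  have y_le_R: "norm (y s) \<le> R s" if s: "s \<in> {a..b}" for s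
  proof (cases "s = a")
    case False
    have "norm (y s - y a) \<le> R s - R a"
    proof (rule differentiable_bound_general[where f' = y' and \<phi>' = u])
      show "continuous_on {a..s} y" "continuous_on {a..s} R"
        using s continuous_on_subset[OF y_cont] continuous_on_subset[OF R_cont] by auto
      show "(y has_vector_derivative y' r) (at r)" "(R has_vector_derivative u r) (at r)"
          "norm (y' r) \<le> u r" if "a < r" "r < s" for r
        using y[of r] R[of r] y'[of r] inner_at[of r] that s by (simp_all add: u_def)
    qed (use False s in auto)
    then show ?thesis
      using norm_triangle_sub[of "y s" "y a"] by (simp add: R_def)
  qed (simp add: R_def)
  \<comment> \<open>By \<open>R' \<le> \<alpha> R + \<beta>\<close>, the function \<open>S - exp (- P) R\<close> is nondecreasing. The mean value inequality,
    applied to it together with the zero function, yields this from derivatives in the open interval.\<close>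
  have "norm ((0::real) - 0) \<le> (S b - exp (- P b) * R b) - (S a - exp (- P a) * R a)"
  proof (rule differentiable_bound_general[where f = "\<lambda>_. 0::real" and f' = "\<lambda>_. 0"
        and \<phi> = "\<lambda>s. S s - exp (- P s) * R s"
        and \<phi>' = "\<lambda>s. exp (- P s) * (\<beta> s - u s + \<alpha> s * R s)"])
    show "continuous_on {a..b} (\<lambda>s. S s - exp (- P s) * R s)"
      by (intro continuous_intros P_cont R_cont S_cont)
    fix s
    assume s: "a < s" "s < b"
    have der: "(P has_real_derivative \<alpha> s) (at s)" "(R has_real_derivative u s) (at s)"
        "(S has_real_derivative exp (- P s) * \<beta> s) (at s)"
      using P[of s] R[of s] S[of s] inner_at[OF s] s
      by (simp_all add: has_real_derivative_iff_has_vector_derivative)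
    have "((\<lambda>s. S s - exp (- P s) * R s) has_real_derivative
        exp (- P s) * (\<beta> s - u s + \<alpha> s * R s)) (at s)"
      by (rule derivative_eq_intros der refl)+ (simp add: algebra_simps)
    then show "((\<lambda>s. S s - exp (- P s) * R s) has_vector_derivative
        exp (- P s) * (\<beta> s - u s + \<alpha> s * R s)) (at s)"
      by (simp add: has_real_derivative_iff_has_vector_derivative)
    have "\<alpha> s * norm (y s) \<le> \<alpha> s * R s"
      using y_le_R[of s] \<alpha>(2)[of s] s by (intro mult_left_mono) auto
    then show "norm (0::real) \<le> exp (- P s) * (\<beta> s - u s + \<alpha> s * R s)"
      by (simp add: u_def)
  qed (use \<open>a < b\<close> in auto)
  then have "exp (- P b) * R b \<le> norm (y a) + S b"
    by (simp add: P_def R_def S_def)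
  then have "exp (P b) * (exp (- P b) * R b) \<le> exp (P b) * (norm (y a) + S b)"
    by (intro mult_left_mono) auto
  then have "R b \<le> exp (P b) * (norm (y a) + S b)"
    by (simp add: exp_minus_inverse flip: mult.assoc)
  with y_le_R[of b] \<open>a \<le> b\<close> show ?thesis
    by (simp add: P_def S_def)
qed simp

section \<open>The bound for the perturbed system\<close>

text \<open>
  Without differentiability of \<open>ln \<parallel>W\<parallel>\<close>, the value of \<^const>\<open>log_norm_rate\<close> would be an arbitrary
  choice; it is a genuine derivative because the largest singular value is simple.
\<close>

lemma integral_log_norm_rate:
  fixes W :: "real \<Rightarrow> real^'n^'n"
  assumes W: "fundamental_matrix t0 A W"
    and simple: "\<And>t. t \<ge> t0 \<Longrightarrow> simple_singular_value (W t) (sigma_max (W t))"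
    and "t0 \<le> a" "a \<le> b"
  shows "(log_norm_rate t0 W has_integral ln (spec_norm (W b)) - ln (spec_norm (W a))) {a..b}"
proof (rule fundamental_theorem_of_calculus[OF \<open>a \<le> b\<close>])
  fix t
  assume t: "t \<in> {a..b}"
  then have "t \<in> {t0..}"
    using \<open>t0 \<le> a\<close> by simp
  have pos: "spec_norm (W s) > 0" if "s \<in> {t0..}" for s
    using W that by (simp add: fundamental_matrix_def spec_norm_pos)
  have "(W has_vector_derivative A t ** W t) (at t within {t0..})"
    using W \<open>t \<in> {t0..}\<close> by (simp add: fundamental_matrix_def)
  then obtain D where "((\<lambda>s. spec_norm (W s)) has_vector_derivative D) (at t within {t0..})"
    using spec_norm_differentiable[where M = W, OF _ \<open>t \<in> {t0..}\<close> pos] simple \<open>t \<in> {t0..}\<close> by auto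
  then have "((\<lambda>s. spec_norm (W s)) has_real_derivative D) (at t within {t0..})"
    by (simp add: has_real_derivative_iff_has_vector_derivative)
  then have "((\<lambda>s. ln (spec_norm (W s))) has_real_derivative D / spec_norm (W t)) (at t within {t0..})"
    using pos[OF \<open>t \<in> {t0..}\<close>] by (auto intro!: derivative_eq_intros)
  then have *: "((\<lambda>s. ln (spec_norm (W s))) has_vector_derivative D / spec_norm (W t)) (at t within {t0..})"
    by (simp add: has_real_derivative_iff_has_vector_derivative)
  have "at t within {t0..} \<noteq> bot"
    using \<open>t \<in> {t0..}\<close> islimpt_subset[of t "{t..t + 1}" "{t0..}"]
    by (auto simp: trivial_limit_within)
  then have "log_norm_rate t0 W t = D / spec_norm (W t)"
    unfolding log_norm_rate_def by (rule vector_derivative_within[OF _ *])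
  with * show "((\<lambda>s. ln (spec_norm (W s))) has_vector_derivative log_norm_rate t0 W t)
      (at t within {a..b})"
    using \<open>t0 \<le> a\<close> by (auto elim!: has_vector_derivative_within_subset)
qed

text \<open>
  The nonlinearity and the forcing enter only through the inequality \<open>\<parallel>g\<parallel> \<le> l \<parallel>x\<parallel> + h\<close> along
  the solution, so this form holds for any perturbation \<open>g\<close> of the linear equation.
\<close>

lemma fundamental_matrix_bound:
  fixes A W :: "real \<Rightarrow> real^'n^'n" and x g :: "real \<Rightarrow> real^'n" and l h :: "real \<Rightarrow> real"
  assumes W: "fundamental_matrix t0 A W"
    and simple: "\<And>s. s \<ge> t0 \<Longrightarrow> simple_singular_value (W s) (sigma_max (W s))"
    and k: "continuous_on {t0..} (\<lambda>s. cond_number (W s))"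
    and l: "continuous_on {t0..t} l" "\<And>s. s \<in> {t0..t} \<Longrightarrow> 0 \<le> l s"
    and h: "continuous_on {t0..t} h"
    and x: "\<And>s. s \<in> {t0..t} \<Longrightarrow>
      (x has_vector_derivative A s *v x s + g s) (at s within {t0..t})"
    and g: "\<And>s. s \<in> {t0..t} \<Longrightarrow> norm (g s) \<le> l s * norm (x s) + h s"
    and "t0 \<le> t"
  shows "norm (x t) \<le>
      spec_norm (W t) * norm (matrix_inv (W t0) *v x t0)
        * exp (integral {t0..t} (\<lambda>s. cond_number (W s) * l s))
      + integral {t0..t} (\<lambda>\<tau>.
          exp (integral {\<tau>..t} (\<lambda>s. log_norm_rate t0 W s + cond_number (W s) * l s))
          * cond_number (W \<tau>) * h \<tau>)"
proof -
  define m where "m s = spec_norm (W s)" for s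
  define n where "n s = spec_norm (matrix_inv (W s))" for s
  define y where "y s = matrix_inv (W s) *v x s" for s
  define kl where "kl s = cond_number (W s) * l s" for s
  have inv: "invertible (W s)" if "s \<in> {t0..}" for s
    using W that by (simp add: fundamental_matrix_def)
  have m_pos: "m s > 0" if "s \<in> {t0..}" for s
    using inv[OF that] by (simp add: m_def spec_norm_pos)
  have n_nonneg: "n s \<ge> 0" for s
    by (simp add: n_def spec_norm_nonneg)
  have k_eq: "cond_number (W s) = m s * n s" for s
    by (simp add: cond_number_def m_def n_def)
  have W': "(W has_vector_derivative A s ** W s) (at s within {t0..})" if "s \<in> {t0..}" for s
    using W that by (simp add: fundamental_matrix_def)
  have m_cont: "continuous_on {t0..} m"
    unfolding continuous_on_eq_continuous_within
  proof
    fix s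
    assume s: "s \<in> {t0..}"
    obtain D where "((\<lambda>r. spec_norm (W r)) has_vector_derivative D) (at s within {t0..})"
      using spec_norm_differentiable[where M = W, OF W'[OF s] s] m_pos simple s by (auto simp: m_def)
    then show "continuous (at s within {t0..}) m"
      unfolding m_def[abs_def] by (rule has_vector_derivative_continuous)
  qed
  \<comment> \<open>Continuity of \<open>\<parallel>W\<^sup>-\<^sup>1\<parallel>\<close> is read off from \<open>\<parallel>W\<^sup>-\<^sup>1\<parallel> = k / \<parallel>W\<parallel>\<close>.\<close>
  have "continuous_on {t0..} (\<lambda>s. cond_number (W s) / m s)"
    using m_pos by (intro continuous_intros k m_cont) (auto simp: less_imp_neq[THEN not_sym])
  then have n_cont: "continuous_on {t0..} n"
    by (rule continuous_on_eq) (use m_pos k_eq in force)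
  have sub: "{t0..t} \<subseteq> {t0..}"
    by auto
  have kl_cont: "continuous_on {t0..t} kl"
    unfolding kl_def by (intro continuous_intros continuous_on_subset[OF k sub] l)
  have y_deriv: "(y has_vector_derivative matrix_inv (W s) *v g s) (at s within {t0..t})"
    if s: "s \<in> {t0..t}" for s
    unfolding y_def[abs_def]
  proof (rule variation_of_constants_derivative[OF _ x[OF s] _ s])
    show "(W has_vector_derivative A s ** W s) (at s within {t0..t})"
      using W'[of s] s by (auto elim: has_vector_derivative_within_subset)
    show "continuous (at s within {t0..t}) (\<lambda>s. spec_norm (matrix_inv (W s)))"
      using continuous_on_subset[OF n_cont sub] s
      by (simp add: n_def[abs_def] continuous_on_eq_continuous_within)
  qed (use inv in auto)
  have x_le: "norm (x s) \<le> m s * norm (y s)" if s: "s \<in> {t0..t}" for s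
  proof -
    have "x s = W s *v y s"
      using inv[of s] s by (simp add: y_def matrix_vector_mul_assoc matrix_inv_right_left)
    then show ?thesis
      by (simp add: m_def norm_mult_le_spec_norm)
  qed
  have y_bound: "norm (matrix_inv (W s) *v g s) \<le> kl s * norm (y s) + n s * h s"
    if s: "s \<in> {t0..t}" for s
  proof -
    have "norm (matrix_inv (W s) *v g s) \<le> n s * norm (g s)"
      by (simp add: n_def norm_mult_le_spec_norm)
    also have "\<dots> \<le> n s * (l s * (m s * norm (y s)) + h s)"
      using g[OF s] mult_left_mono[OF x_le[OF s] l(2)[OF s]] n_nonneg
      by (intro mult_left_mono) auto
    also have "\<dots> = kl s * norm (y s) + n s * h s"
      by (simp add: kl_def k_eq algebra_simps)
    finally show ?thesis .
  qed
  define P where "P s = integral {t0..s} kl" for s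
  have "norm (y t) \<le> exp (P t) * (norm (y t0) + integral {t0..t} (\<lambda>\<tau>. exp (- P \<tau>) * (n \<tau> * h \<tau>)))"
    unfolding P_def
  proof (rule gronwall_differential_inequality[OF \<open>t0 \<le> t\<close> kl_cont _ _ y_deriv y_bound])
    show "0 \<le> kl s" if "s \<in> {t0..t}" for s
      using l(2)[OF that] m_pos[of s] n_nonneg[of s] that by (simp add: kl_def k_eq)
    show "continuous_on {t0..t} (\<lambda>s. n s * h s)"
      by (intro continuous_intros continuous_on_subset[OF n_cont sub] h)
  qed
  then have "m t * norm (y t)
      \<le> m t * (exp (P t) * (norm (y t0) + integral {t0..t} (\<lambda>\<tau>. exp (- P \<tau>) * (n \<tau> * h \<tau>))))"
    using m_pos[of t] \<open>t0 \<le> t\<close> by (intro mult_left_mono) auto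
  then have "norm (x t) \<le> m t * norm (y t0) * exp (P t)
      + integral {t0..t} (\<lambda>\<tau>. m t * exp (P t) * (exp (- P \<tau>) * (n \<tau> * h \<tau>)))"
    unfolding integral_mult_right using x_le[of t] \<open>t0 \<le> t\<close> by (simp add: algebra_simps)
  also have "integral {t0..t} (\<lambda>\<tau>. m t * exp (P t) * (exp (- P \<tau>) * (n \<tau> * h \<tau>)))
      = integral {t0..t} (\<lambda>\<tau>. exp (integral {\<tau>..t} (\<lambda>s. log_norm_rate t0 W s + kl s))
          * cond_number (W \<tau>) * h \<tau>)"
  proof (rule integral_cong)
    fix \<tau>
    assume \<tau>: "\<tau> \<in> {t0..t}"
    have kl_int: "kl integrable_on {t0..t}" "kl integrable_on {\<tau>..t}"
      using \<tau> kl_cont by (auto intro!: integrable_continuous_real elim: continuous_on_subset)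
    have p_int: "(log_norm_rate t0 W has_integral ln (m t) - ln (m \<tau>)) {\<tau>..t}"
      unfolding m_def using \<tau> by (intro integral_log_norm_rate[OF W simple]) auto
    have "integral {\<tau>..t} kl = P t - P \<tau>"
      unfolding P_def using Henstock_Kurzweil_Integration.integral_combine[OF _ _ kl_int(1), of \<tau>] \<tau> by simp
    then have "integral {\<tau>..t} (\<lambda>s. log_norm_rate t0 W s + kl s)
        = ln (m t) - ln (m \<tau>) + (P t - P \<tau>)"
      using p_int kl_int(2) by (simp add: integral_add has_integral_iff)
    then have "exp (integral {\<tau>..t} (\<lambda>s. log_norm_rate t0 W s + kl s))
        = m t / m \<tau> * exp (P t) * exp (- P \<tau>)"
      using m_pos[of t] m_pos[of \<tau>] \<tau> by (simp add: exp_add exp_diff exp_minus divide_inverse)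
    then show "m t * exp (P t) * (exp (- P \<tau>) * (n \<tau> * h \<tau>))
      = exp (integral {\<tau>..t} (\<lambda>s. log_norm_rate t0 W s + kl s)) * cond_number (W \<tau>) * h \<tau>"
      using m_pos[of \<tau>] \<tau> by (simp add: k_eq)
  qed
  finally show ?thesis
    by (simp add: m_def y_def P_def kl_def[abs_def])
qed

theorem theorem1:
  fixes A W :: "real \<Rightarrow> real^'n^'n"
    and f :: "real \<Rightarrow> real^'n \<Rightarrow> real^'n"
    and F :: "real \<Rightarrow> real^'n"
    and x :: "real \<Rightarrow> real^'n"
    and x0 :: "real^'n"
    and \<Omega> :: "(real^'n) set"
    and l :: "real \<Rightarrow> real"
    and t0 l_hat \<sigma>_upper \<sigma>_lower :: real
  assumes A_cont: "continuous_on {t0..} A"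
    and A_bounded: "bounded (A ` {t0..})"
    and A_C1: "cont_differentiable_from t0 A"
    and f_cont: "continuous_on ({t0..} \<times> UNIV) (\<lambda>(t, y). f t y)"
    and f_bounded: "bounded ((\<lambda>(t, y). f t y) ` ({t0..} \<times> UNIV))"
    and f_zero: "\<And>t. t \<ge> t0 \<Longrightarrow> f t 0 = 0"
    and F_cont: "continuous_on {t0..} F"
    and F_bounded: "bounded (F ` {t0..})"
    and x_solution: "unique_ivp_solution t0 (\<lambda>t y. A t *v y + f t y + F t) x0 x"
    and W_fundamental: "fundamental_matrix t0 A W"
    and W_init: "spec_norm (W t0) = 1"
    and \<sigma>_max_simple: "\<And>t. t \<ge> t0 \<Longrightarrow> simple_singular_value (W t) (sigma_max (W t))"
    and \<sigma>_max_le: "\<And>t. t \<ge> t0 \<Longrightarrow> sigma_max (W t) \<le> \<sigma>_upper"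
    and \<sigma>_min_ge: "\<And>t. t \<ge> t0 \<Longrightarrow> sigma_min (W t) \<ge> \<sigma>_lower"
    and \<Omega>_nbhd: "0 \<in> interior \<Omega>"
    and l_cont: "continuous_on {t0..} l"
    and l_le: "\<And>t. t \<ge> t0 \<Longrightarrow> l t \<le> l_hat"
    and f_le: "\<And>t y. t \<ge> t0 \<Longrightarrow> y \<in> \<Omega> \<Longrightarrow> norm (f t y) \<le> l t * norm y"
    and k_cont: "continuous_on {t0..} (\<lambda>t. cond_number (W t))"
    and k_bounded: "bounded ((\<lambda>t. cond_number (W t)) ` {t0..})"
    and norm_F_cont: "continuous_on {t0..} (\<lambda>t. norm (F t))"
    and norm_F_bounded: "bounded ((\<lambda>t. norm (F t)) ` {t0..})"
    and p_cont: "continuous_on {t0..} (log_norm_rate t0 W)"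
  shows "\<forall>t\<ge>t0. (\<forall>s\<in>{t0..t}. x s \<in> \<Omega>) \<longrightarrow>
    norm (x t) \<le>
      spec_norm (W t) * norm (matrix_inv (W t0) *v x0)
        * exp (integral {t0..t} (\<lambda>s. cond_number (W s) * l s))
      + integral {t0..t} (\<lambda>\<tau>.
          exp (integral {\<tau>..t} (\<lambda>s. log_norm_rate t0 W s + cond_number (W s) * l s))
          * cond_number (W \<tau>) * norm (F \<tau>))"
proof (intro allI impI)
  fix t
  assume "t \<ge> t0" and \<Omega>: "\<forall>s\<in>{t0..t}. x s \<in> \<Omega>"
  have x_init: "x t0 = x0"
    using x_solution by (simp add: unique_ivp_solution_def solves_ivp_def)
  have x_deriv: "(x has_vector_derivative A s *v x s + f s (x s) + F s) (at s within {t0..})"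
    if "s \<ge> t0" for s
    using x_solution that by (auto simp: unique_ivp_solution_def solves_ivp_def)
  \<comment> \<open>The bound \<open>0 \<le> \<parallel>f(s, v)\<parallel> \<le> l(s) \<parallel>v\<parallel>\<close> at one nonzero \<open>v \<in> \<Omega>\<close> settles the sign of \<open>l(s)\<close>.\<close>
  have l_nonneg: "0 \<le> l s" if "s \<ge> t0" for s
  proof -
    obtain e where "e > 0" and e: "cball 0 e \<subseteq> \<Omega>"
      using \<Omega>_nbhd by (auto simp: mem_interior_cball)
    obtain v :: "real^'n" where "norm v = e"
      using vector_choose_size[of e] \<open>e > 0\<close> by auto
    then have "v \<in> \<Omega>"
      using e by auto
    then have "0 \<le> l s * e"
      using f_le[OF that, of v] norm_ge_zero[of "f s v"] \<open>norm v = e\<close> by (metis order_trans)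
    then show ?thesis
      using \<open>e > 0\<close> by (simp add: zero_le_mult_iff)
  qed
  show "norm (x t) \<le>
      spec_norm (W t) * norm (matrix_inv (W t0) *v x0)
        * exp (integral {t0..t} (\<lambda>s. cond_number (W s) * l s))
      + integral {t0..t} (\<lambda>\<tau>.
          exp (integral {\<tau>..t} (\<lambda>s. log_norm_rate t0 W s + cond_number (W s) * l s))
          * cond_number (W \<tau>) * norm (F \<tau>))"
    unfolding x_init[symmetric]
  proof (rule fundamental_matrix_bound[OF W_fundamental \<sigma>_max_simple k_cont])
    show "continuous_on {t0..t} l" "continuous_on {t0..t} (\<lambda>s. norm (F s))"
      using l_cont norm_F_cont by (auto elim: continuous_on_subset)
    fix s
    assume s: "s \<in> {t0..t}"
    show "(x has_vector_derivative A s *v x s + (f s (x s) + F s)) (at s within {t0..t})"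
      using x_deriv[of s] s by (auto simp: add.assoc elim: has_vector_derivative_within_subset)
    show "norm (f s (x s) + F s) \<le> l s * norm (x s) + norm (F s)"
      using norm_triangle_ineq[of "f s (x s)" "F s"] f_le[of s "x s"] \<Omega> s by force
  qed (use l_nonneg \<open>t \<ge> t0\<close> in auto)
qed

end
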